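(* For the online task assignment problem with controllable processing time described in the context, for every $\zeta>0$ no online algorithm is $(\tfrac12+\zeta)$-competitive, even when $q_e=1$ for all $e\in E$ and $L=1$.
   Context: Problem. Let $G=(U,V;E)$ be a finite bipartite graph with machines $U$, task types $V$ and edges $E$; an edge is written $e=(u,v)$. There are $L$ processing levels $\mathcal{L}=\{1,\dots,L\}$. Processing task $v$ on machine $u$ at level $l$ gives reward $r_{u,v,l}$, increasing in $l$. The time horizon is $[T]=\{1,\dots,T\}$. Level $l$ has a random processing delay $d_l$, a positive integer drawn from a known distribution $D_l$, with $\mathbb{E}[d_l]$ increasing in $l$. At each time $t$ at most one task arrives: type $v$ arrives with known probability $p_{v,t}$ ($\sum_v p_{v,t}\le 1$), independently across times. When $v$ arrives at $t$, the algorithm must immediately and irrevocably either discard it or assign it to an available machine $u$ with $(u,v)\in E$ together with a level $l$. Machine $u$ accepts with probability $q_e$; on acceptance the reward $r_{u,v,l}$ is collected and $u$ is unavailable to other tasks until time $t+d_l$. On rejection a penalty $\theta_l$ (positive integer) is subtracted from $u$'s remaining budget, initially $\Delta_u$ (a positive integer or $\infty$); a machine whose budget becomes $\le 0$ is permanently removed. An online algorithm decides at time $t$ knowing only arrivals up to $t$. Benchmark. For a realized arrival sequence $I$, $\text{OPT}(I)$ is the maximum expected total reward of an algorithm that knows $I$ in advance but learns acceptance/rejection outcomes (and delays) only when they occur. An algorithm ALG is $\alpha$-competitive if $\mathbb{E}_I[\text{ALG}(I)]\ge\alpha\,\mathbb{E}_I[\text{OPT}(I)]$ for every instance. *)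

theory Defs
  imports "HOL-Probability.Probability" "HOL-Library.Extended_Nat"
begin

record ('u, 'v) problem =
  machines :: "'u set"
  tasks :: "'v set"
  edges :: "('u \<times> 'v) set"
  levels :: nat
  horizon :: nat
  reward :: "'u \<Rightarrow> 'v \<Rightarrow> nat \<Rightarrow> real"
  delay :: "nat \<Rightarrow> nat pmf"
  arrival_prob :: "'v \<Rightarrow> nat \<Rightarrow> real"
  accept_prob :: "'u \<times> 'v \<Rightarrow> real"
  penalty :: "nat \<Rightarrow> nat"
  budget :: "'u \<Rightarrow> enat"

definition valid_problem :: "('u, 'v) problem \<Rightarrow> bool" where
  "valid_problem P \<longleftrightarrow>
     finite (machines P) \<and> finite (tasks P) \<and> edges P \<subseteq> machines P \<times> tasks P \<and>
     1 \<le> levels P \<and> 1 \<le> horizon P \<and>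
     (\<forall>(u, v)\<in>edges P. \<forall>l\<in>{1..levels P}. 0 \<le> reward P u v l) \<and>
     (\<forall>(u, v)\<in>edges P. strict_mono_on {1..levels P} (reward P u v)) \<and>
     (\<forall>l\<in>{1..levels P}. 0 \<notin> set_pmf (delay P l) \<and> integrable (measure_pmf (delay P l)) real) \<and>
     strict_mono_on {1..levels P} (\<lambda>l. measure_pmf.expectation (delay P l) real) \<and>
     (\<forall>v\<in>tasks P. \<forall>t\<in>{1..horizon P}. 0 \<le> arrival_prob P v t) \<and>
     (\<forall>t\<in>{1..horizon P}. (\<Sum>v\<in>tasks P. arrival_prob P v t) \<le> 1) \<and>
     (\<forall>e\<in>edges P. 0 \<le> accept_prob P e \<and> accept_prob P e \<le> 1) \<and>
     (\<forall>l\<in>{1..levels P}. 0 < penalty P l) \<and>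
     (\<forall>u\<in>machines P. 0 < budget P u)"

(* None: no task arrives at time t. *)
definition arrival_pmf :: "('u, 'v) problem \<Rightarrow> nat \<Rightarrow> 'v option pmf" where
  "arrival_pmf P t = embed_pmf (\<lambda>a. case a of
       None \<Rightarrow> 1 - (\<Sum>v\<in>tasks P. arrival_prob P v t)
     | Some v \<Rightarrow> if v \<in> tasks P then arrival_prob P v t else 0)"

lemma pmf_arrival_pmf:
  assumes "valid_problem P" and t: "t \<in> {1..horizon P}"
  shows "pmf (arrival_pmf P t) a = (case a of
       None \<Rightarrow> 1 - (\<Sum>v\<in>tasks P. arrival_prob P v t)
     | Some v \<Rightarrow> if v \<in> tasks P then arrival_prob P v t else 0)"
proof -
  let ?f = "\<lambda>a. case a of
       None \<Rightarrow> 1 - (\<Sum>v\<in>tasks P. arrival_prob P v t)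
     | Some v \<Rightarrow> if v \<in> tasks P then arrival_prob P v t else 0"
  let ?S = "insert None (Some ` tasks P)"
  have fin: "finite (tasks P)" and nn: "\<And>v. v \<in> tasks P \<Longrightarrow> 0 \<le> arrival_prob P v t"
    and le: "(\<Sum>v\<in>tasks P. arrival_prob P v t) \<le> 1"
    using assms unfolding valid_problem_def by auto
  have f_nn: "0 \<le> ?f x" for x
    using nn le by (auto split: option.split)
  have "(\<integral>\<^sup>+ x. ennreal (?f x) \<partial>count_space UNIV) = (\<Sum>x\<in>?S. ennreal (?f x))"
    by (rule nn_integral_count_space') (use fin in \<open>auto split: option.splits if_splits\<close>)
  also have "\<dots> = ennreal (\<Sum>x\<in>?S. ?f x)"
    using f_nn by (intro sum_ennreal) auto
  also have "(\<Sum>x\<in>?S. ?f x) = 1"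
    using fin by (simp add: sum.reindex)
  finally have "(\<integral>\<^sup>+ x. ennreal (?f x) \<partial>count_space UNIV) = 1" by simp
  from pmf_embed_pmf[OF f_nn this] show ?thesis
    unfolding arrival_pmf_def by simp
qed

definition arrivals :: "('u, 'v) problem \<Rightarrow> (nat \<Rightarrow> 'v option) pmf" where
  "arrivals P = Pi_pmf {1..horizon P} None (arrival_pmf P)"

datatype 'u decision = Discard | Assign 'u nat

(* The last component of Accepted is the delay (as realized, or as known to the decision maker). *)
datatype ('u, 'd) event = Unassigned | Rejected 'u nat | Accepted 'u nat 'd

(* The s-th entry of a log (counting from 0) is what happened at time s + 1. A log of length n
   is therefore the history just before the decision at time n + 1. *)
type_synonym 'u log = "('u, nat) event list"
type_synonym 'u observed_log = "('u, nat option) event list"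

(* The delay of an accepted task is visible only once the task has been completed. *)
definition observe :: "'u log \<Rightarrow> 'u observed_log" where
  "observe h = map (\<lambda>s. map_event id
       (\<lambda>d. if Suc s + d \<le> Suc (length h) then Some d else None) (h ! s)) [0..<length h]"

definition spent :: "('u, 'v) problem \<Rightarrow> 'u log \<Rightarrow> 'u \<Rightarrow> nat" where
  "spent P h u = (\<Sum>e\<leftarrow>h. case e of Rejected u' l \<Rightarrow> (if u' = u then penalty P l else 0) | _ \<Rightarrow> 0)"

(* The last conjunct says that the remaining budget is positive. *)
definition available :: "('u, 'v) problem \<Rightarrow> 'u log \<Rightarrow> 'u \<Rightarrow> bool" where
  "available P h u \<longleftrightarrow>
     (\<forall>s<length h. \<forall>l d. h ! s = Accepted u l d \<longrightarrow> Suc s + d \<le> Suc (length h)) \<and>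
     enat (spent P h u) < budget P u"

definition feasible :: "('u, 'v) problem \<Rightarrow> 'v option \<Rightarrow> 'u log \<Rightarrow> 'u decision set" where
  "feasible P a h = insert Discard
     {Assign u l | u l v. a = Some v \<and> (u, v) \<in> edges P \<and> l \<in> {1..levels P} \<and> available P h u}"

(* A (randomized) strategy for one fixed arrival sequence. Past decisions are part of the
   observed log, so this covers memory and shared randomness. *)
type_synonym 'u strategy = "'u observed_log \<Rightarrow> 'u decision pmf"

definition admissible :: "('u, 'v) problem \<Rightarrow> (nat \<Rightarrow> 'v option) \<Rightarrow> 'u strategy \<Rightarrow> bool" where
  "admissible P I \<sigma> \<longleftrightarrow>
     (\<forall>h. length h < horizon P \<longrightarrow> set_pmf (\<sigma> (observe h)) \<subseteq> feasible P (I (Suc (length h))) h)"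

fun event_pmf :: "('u, 'v) problem \<Rightarrow> 'v option \<Rightarrow> 'u decision \<Rightarrow> ('u, nat) event pmf" where
  "event_pmf P (Some v) (Assign u l) =
     bind_pmf (bernoulli_pmf (accept_prob P (u, v))) (\<lambda>accepted.
       if accepted then map_pmf (Accepted u l) (delay P l) else return_pmf (Rejected u l))"
| "event_pmf P _ _ = return_pmf Unassigned"

primrec run :: "('u, 'v) problem \<Rightarrow> (nat \<Rightarrow> 'v option) \<Rightarrow> 'u strategy \<Rightarrow> nat \<Rightarrow> 'u log pmf" where
  "run P I \<sigma> 0 = return_pmf []"
| "run P I \<sigma> (Suc n) =
     bind_pmf (run P I \<sigma> n) (\<lambda>h.
     bind_pmf (\<sigma> (observe h)) (\<lambda>x.
     map_pmf (\<lambda>e. h @ [e]) (event_pmf P (I (Suc n)) x)))"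

definition total_reward :: "('u, 'v) problem \<Rightarrow> (nat \<Rightarrow> 'v option) \<Rightarrow> 'u log \<Rightarrow> real" where
  "total_reward P I h = (\<Sum>s<length h. case (I (Suc s), h ! s) of
       (Some v, Accepted u l d) \<Rightarrow> reward P u v l
     | _ \<Rightarrow> 0)"

definition expected_reward :: "('u, 'v) problem \<Rightarrow> (nat \<Rightarrow> 'v option) \<Rightarrow> 'u strategy \<Rightarrow> real" where
  "expected_reward P I \<sigma> = measure_pmf.expectation (run P I \<sigma> (horizon P)) (total_reward P I)"

definition OPT :: "('u, 'v) problem \<Rightarrow> (nat \<Rightarrow> 'v option) \<Rightarrow> real" where
  "OPT P I = (SUP \<sigma>\<in>{\<sigma>. admissible P I \<sigma>}. expected_reward P I \<sigma>)"

(* An online policy sees the arrivals up to and including the current time. *)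
type_synonym ('u, 'v) online_policy = "'v option list \<Rightarrow> 'u observed_log \<Rightarrow> 'u decision pmf"

definition strategy_of :: "('u, 'v) online_policy \<Rightarrow> (nat \<Rightarrow> 'v option) \<Rightarrow> 'u strategy" where
  "strategy_of \<pi> I = (\<lambda>h. \<pi> (map I [1..<Suc (Suc (length h))]) h)"

(* An online algorithm knows the problem data, including all distributions, beforehand. *)
type_synonym ('u, 'v) algorithm = "('u, 'v) problem \<Rightarrow> ('u, 'v) online_policy"

definition online_algorithm :: "('u, 'v) algorithm \<Rightarrow> bool" where
  "online_algorithm ALG \<longleftrightarrow>
     (\<forall>P. valid_problem P \<longrightarrow> (\<forall>I. admissible P I (strategy_of (ALG P) I)))"

definition competitive_on :: "('u, 'v) problem set \<Rightarrow> real \<Rightarrow> ('u, 'v) algorithm \<Rightarrow> bool" where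
  "competitive_on C \<alpha> ALG \<longleftrightarrow>
     (\<forall>P\<in>C. measure_pmf.expectation (arrivals P) (\<lambda>I. expected_reward P I (strategy_of (ALG P) I))
        \<ge> \<alpha> * measure_pmf.expectation (arrivals P) (OPT P))"

end

theory Submission
  imports Defs
begin

text \<open>
  A prophet-inequality instance: one machine, delay 2, horizon 2. Task 0 arrives at time 1 for sure
  and pays 1; task 1 arrives at time 2 with probability \<open>\<epsilon>\<close> and pays \<open>1 / \<epsilon>\<close>. Serving task 0 blocks
  the machine at time 2, and either choice at time 1 is worth at most 1 in expectation to an online
  algorithm. Knowing the arrivals, one serves task 1 if it arrives and task 0 otherwise, which
  earns \<open>\<epsilon> \<cdot> (1 / \<epsilon>) + (1 - \<epsilon>) \<cdot> 1 = 2 - \<epsilon>\<close>.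
\<close>

definition prophet_problem :: "real \<Rightarrow> (nat, nat) problem" where
  "prophet_problem \<epsilon> =
     \<lparr>machines = {0}, tasks = {0, 1}, edges = {0} \<times> {0, 1}, levels = 1, horizon = 2,
      reward = (\<lambda>u v l. if v = 0 then 1 else 1 / \<epsilon>),
      delay = (\<lambda>l. return_pmf 2),
      arrival_prob = (\<lambda>v t. if t = 1 then (if v = 0 then 1 else 0) else (if v = 0 then 0 else \<epsilon>)),
      accept_prob = (\<lambda>e. 1), penalty = (\<lambda>l. 1), budget = (\<lambda>u. \<infinity>)\<rparr>"

text \<open>The flag \<open>b\<close> says whether task 1 arrives. The value \<open>None\<close>
  outside the horizon is the default that \<open>Pi_pmf\<close> imposes in
  \<open>arrivals\<close>.\<close>

definition prophet_arrivals :: "bool \<Rightarrow> nat \<Rightarrow> nat option" where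
  "prophet_arrivals b = (\<lambda>_. None)(1 := Some 0, 2 := if b then Some 1 else None)"

lemma prophet_problem_sel [simp]:
  "machines (prophet_problem \<epsilon>) = {0}"
  "tasks (prophet_problem \<epsilon>) = {0, 1}"
  "edges (prophet_problem \<epsilon>) = {0} \<times> {0, 1}"
  "levels (prophet_problem \<epsilon>) = 1"
  "horizon (prophet_problem \<epsilon>) = 2"
  "reward (prophet_problem \<epsilon>) u v l = (if v = 0 then 1 else 1 / \<epsilon>)"
  "delay (prophet_problem \<epsilon>) l = return_pmf 2"
  "accept_prob (prophet_problem \<epsilon>) e = 1"
  "penalty (prophet_problem \<epsilon>) l = 1"
  "budget (prophet_problem \<epsilon>) u = \<infinity>"
  "arrival_prob (prophet_problem \<epsilon>) v t =
     (if t = 1 then (if v = 0 then 1 else 0) else (if v = 0 then 0 else \<epsilon>))"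
  by (simp_all add: prophet_problem_def)

lemma prophet_arrivals_simps [simp]:
  "prophet_arrivals b (Suc 0) = Some 0"
  "prophet_arrivals b 2 = (if b then Some 1 else None)"
  "prophet_arrivals b (Suc (Suc 0)) = (if b then Some 1 else None)"
  by (simp_all add: prophet_arrivals_def numeral_2_eq_2)

lemma valid_prophet_problem:
  assumes "0 < \<epsilon>" "\<epsilon> \<le> 1"
  shows "valid_problem (prophet_problem \<epsilon>)"
  using assms
  by (auto simp: valid_problem_def strict_mono_on_def intro!: integrable_measure_pmf_finite)

text \<open>Time 1 is deterministic, so the product distribution collapses to the single coin tossed
  at time 2. Expectations over arrivals thereby become two-term sums.\<close>

lemma arrivals_prophet_problem:
  assumes "0 < \<epsilon>" "\<epsilon> \<le> 1"
  shows "arrivals (prophet_problem \<epsilon>) = map_pmf prophet_arrivals (bernoulli_pmf \<epsilon>)"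
proof -
  note pmf_arr = pmf_arrival_pmf[OF valid_prophet_problem[OF assms]]
  have arr1: "arrival_pmf (prophet_problem \<epsilon>) 1 = return_pmf (Some 0)"
    by (rule pmf_eqI) (auto simp: pmf_arr pmf_return split: option.split)
  have arr2: "arrival_pmf (prophet_problem \<epsilon>) 2 =
      map_pmf (\<lambda>b. if b then Some 1 else None) (bernoulli_pmf \<epsilon>)"
  proof (rule pmf_eqI)
    fix a :: "nat option"
    have preim: "(\<lambda>b. if b then Some 1 else None) -` {a} =
        (if a = Some 1 then {True} else if a = None then {False} else {})"
      by (auto split: if_splits)
    show "pmf (arrival_pmf (prophet_problem \<epsilon>) 2) a =
        pmf (map_pmf (\<lambda>b. if b then Some 1 else None) (bernoulli_pmf \<epsilon>)) a"
      using assms by (auto simp: pmf_arr pmf_map preim measure_pmf_single split: option.split)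
  qed
  have "{1..2} = insert 1 {2 :: nat}" by auto
  then have "arrivals (prophet_problem \<epsilon>) =
      map_pmf (\<lambda>(y, f). f(1 := y)) (pair_pmf (return_pmf (Some 0))
        (map_pmf (\<lambda>y x. if x = 2 then y else None)
          (map_pmf (\<lambda>b. if b then Some 1 else None) (bernoulli_pmf \<epsilon>))))"
    unfolding arrivals_def by (simp add: Pi_pmf_insert Pi_pmf_singleton arr1 [simplified] arr2)
  then show ?thesis
    by (auto simp: pair_return_pmf1 map_pmf_comp prophet_arrivals_def fun_eq_iff intro!: map_pmf_cong)
qed

lemma bernoulli_pmf_1: "bernoulli_pmf 1 = return_pmf True"
proof (rule pmf_eqI)
  show "pmf (bernoulli_pmf 1) b = pmf (return_pmf True) b" for b
    by (cases b) (auto simp: pmf_return)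
qed

lemma length_run: "h \<in> set_pmf (run P I \<sigma> n) \<Longrightarrow> length h = n"
  by (induction n arbitrary: h) auto

lemma abs_total_reward_le:
  assumes "\<And>u v l. \<bar>reward P u v l\<bar> \<le> B"
  shows "\<bar>total_reward P I h\<bar> \<le> real (length h) * B"
proof -
  \<comment> \<open>Time steps without an accepted task contribute 0, which must also lie below
    \<open>B\<close>; any instance of the hypothesis gives this.\<close>
  have "B \<ge> 0" using assms[of undefined undefined undefined] by linarith
  then have "\<bar>total_reward P I h\<bar> \<le> (\<Sum>s<length h. B)"
    unfolding total_reward_def
    by (intro order_trans[OF sum_abs] sum_mono) (use assms in \<open>auto split: option.split event.split\<close>)
  then show ?thesis by simp
qed

lemma integrable_total_reward:
  assumes "\<And>u v l. \<bar>reward P u v l\<bar> \<le> B"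
  shows "integrable (run P I \<sigma> n) (total_reward P I)"
  by (rule measure_pmf.integrable_const_bound[of _ "real n * B"])
    (use abs_total_reward_le[of P B I, OF assms] in
      \<open>auto simp: AE_measure_pmf_iff dest!: length_run\<close>)

text \<open>\<open>OPT\<close> is a supremum of reals, so it dominates its members only once they
  are known to be bounded. A log has one entry per time step, which gives a bound independent of the
  strategy.\<close>

lemma bdd_above_expected_reward:
  assumes "\<And>u v l. \<bar>reward P u v l\<bar> \<le> B"
  shows "bdd_above (expected_reward P I ` S)"
proof (rule bdd_aboveI2)
  have "total_reward P I h \<le> real n * B" if "h \<in> set_pmf (run P I \<sigma> n)" for h n \<sigma>
    using abs_total_reward_le[of P B I h, OF assms] length_run[OF that] by (simp add: abs_le_iff)
  then show "expected_reward P I \<sigma> \<le> real (horizon P) * B" for \<sigma>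
    unfolding expected_reward_def
    by (intro measure_pmf.integral_le_const integrable_total_reward[of P B] assms)
      (auto simp: AE_measure_pmf_iff)
qed

lemma expected_reward_le_OPT:
  assumes "\<And>u v l. \<bar>reward P u v l\<bar> \<le> B" "admissible P I \<sigma>"
  shows "expected_reward P I \<sigma> \<le> OPT P I"
  unfolding OPT_def using assms by (intro cSUP_upper bdd_above_expected_reward) auto

lemma observe_Nil [simp]: "observe [] = []"
  by (simp add: observe_def)

lemma observe_eq_Nil_iff [simp]: "observe h = [] \<longleftrightarrow> h = []"
  by (simp add: observe_def)

text \<open>Observation hides only delays, and \<open>Unassigned\<close> carries none. A strategy
  seeing this log therefore knows that the machine is free.\<close>

lemma observe_eq_Unassigned_iff [simp]: "observe h = [Unassigned] \<longleftrightarrow> h = [Unassigned]"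
proof (cases h)
  case (Cons e h')
  then show ?thesis by (cases h'; cases e) (auto simp: observe_def upt_rec)
qed auto

text \<open>Admissibility ranges over all logs, even those the strategy never produces. Testing for
  \<open>[Unassigned]\<close>, not just for length 1, rules out assigning to a busy machine.\<close>

definition wait_strategy :: "nat strategy" where
  "wait_strategy h = return_pmf (if h = [Unassigned] then Assign 0 1 else Discard)"

definition immediate_strategy :: "nat strategy" where
  "immediate_strategy h = return_pmf (if h = [] then Assign 0 1 else Discard)"

lemma OPT_prophet_problem_True:
  assumes "0 < \<epsilon>" "\<epsilon> \<le> 1"
  shows "1 / \<epsilon> \<le> OPT (prophet_problem \<epsilon>) (prophet_arrivals True)"
proof -
  let ?P = "prophet_problem \<epsilon>" and ?I = "prophet_arrivals True"
  have "admissible ?P ?I wait_strategy"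
    by (auto simp: admissible_def wait_strategy_def feasible_def available_def)
  then have "expected_reward ?P ?I wait_strategy \<le> OPT ?P ?I"
    \<comment> \<open>\<open>1 / \<epsilon>\<close> bounds both rewards since \<epsilon> \<le>
      1.\<close>
    by (rule expected_reward_le_OPT[of _ "1 / \<epsilon>", rotated]) (use assms in auto)
  also have "expected_reward ?P ?I wait_strategy = 1 / \<epsilon>"
    by (simp add: expected_reward_def numeral_2_eq_2 wait_strategy_def bind_return_pmf
        bernoulli_pmf_1 total_reward_def)
  finally show ?thesis .
qed

lemma OPT_prophet_problem_False:
  assumes "0 < \<epsilon>" "\<epsilon> \<le> 1"
  shows "1 \<le> OPT (prophet_problem \<epsilon>) (prophet_arrivals False)"
proof -
  let ?P = "prophet_problem \<epsilon>" and ?I = "prophet_arrivals False"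
  have "admissible ?P ?I immediate_strategy"
    by (auto simp: admissible_def immediate_strategy_def feasible_def available_def)
  then have "expected_reward ?P ?I immediate_strategy \<le> OPT ?P ?I"
    by (rule expected_reward_le_OPT[of _ "1 / \<epsilon>", rotated]) (use assms in auto)
  also have "expected_reward ?P ?I immediate_strategy = 1"
    by (simp add: expected_reward_def numeral_2_eq_2 immediate_strategy_def bind_return_pmf
        bernoulli_pmf_1 total_reward_def)
  finally show ?thesis .
qed

text \<open>Taking task 0 earns 1 and blocks time 2; discarding it leaves at most the reward of task
  1, if that arrives. Only the law of the first decision matters, hence the bound in terms of
  \<open>p\<close>.\<close>

lemma expected_reward_prophet_problem_le:
  assumes "0 < \<epsilon>" "\<epsilon> \<le> 1" and adm: "admissible (prophet_problem \<epsilon>) (prophet_arrivals b) \<sigma>"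
  defines "p \<equiv> pmf (\<sigma> []) (Assign 0 1)"
  shows "expected_reward (prophet_problem \<epsilon>) (prophet_arrivals b) \<sigma>
    \<le> p + (if b then (1 - p) / \<epsilon> else 0)"
proof -
  let ?P = "prophet_problem \<epsilon>" and ?I = "prophet_arrivals b"
  let ?tail = "\<lambda>h. bind_pmf (\<sigma> (observe h))
    (\<lambda>x. map_pmf (\<lambda>e. h @ [e]) (event_pmf ?P (?I 2) x))"
  \<comment> \<open>Acceptance is certain and the delay is constant, so the first decision
    determines the log.\<close>
  let ?first = "\<lambda>x :: nat decision.
    if x = Assign 0 1 then [Accepted 0 1 2] else [Unassigned] :: nat log"
  \<comment> \<open>The most that a machine free at time 2 can still earn.\<close>
  define c where "c = (if b then 1 / \<epsilon> else 0)"
  have c_nonneg: "c \<ge> 0" using assms by (simp add: c_def)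
  have dec1: "x = Discard \<or> x = Assign 0 1" if "x \<in> set_pmf (\<sigma> [])" for x
    using adm[unfolded admissible_def, rule_format, of "[]"] that by (auto simp: feasible_def)
  \<comment> \<open>A task accepted at time 1 with delay 2 ends at time 3, just too late for
    availability at time 2.\<close>
  have dec2: "x = Discard \<or> x = Assign 0 1 \<and> h = [Unassigned]"
    if "x \<in> set_pmf (\<sigma> (observe h))" "h = [Unassigned] \<or> h = [Accepted 0 1 2]" for x h
    using adm[unfolded admissible_def, rule_format, of h] that
    by (auto simp: feasible_def available_def)
  have "run ?P ?I \<sigma> 2 = bind_pmf (\<sigma> []) (\<lambda>x. bind_pmf
      (map_pmf (\<lambda>e. [e]) (event_pmf ?P (Some 0) x)) ?tail)"
    by (simp add: numeral_2_eq_2 bind_return_pmf bind_assoc_pmf)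
  also have "\<dots> = bind_pmf (\<sigma> []) (\<lambda>x. ?tail (?first x))"
    by (rule bind_pmf_cong[OF refl])
      (auto dest!: dec1 simp: bernoulli_pmf_1 bind_return_pmf)
  finally have run: "run ?P ?I \<sigma> 2 = bind_pmf (\<sigma> []) (\<lambda>x. ?tail (?first x))" .
  have le: "total_reward ?P ?I h \<le> (if hd h = Unassigned then c else 1)"
    if h: "h \<in> set_pmf (run ?P ?I \<sigma> 2)" for h
  proof -
    from h obtain x y where y: "y \<in> set_pmf (\<sigma> (observe (?first x)))"
      and h': "h \<in> set_pmf (map_pmf (\<lambda>e. ?first x @ [e]) (event_pmf ?P (?I 2) y))"
      unfolding run set_bind_pmf by blast
    from dec2[OF y] have "y = Discard \<or> y = Assign 0 1 \<and> ?first x = [Unassigned]" by auto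
    with h' c_nonneg show ?thesis
      by (auto simp: total_reward_def c_def bernoulli_pmf_1 bind_return_pmf numeral_2_eq_2
          split: if_splits)
  qed
  \<comment> \<open>Time 2 only appends to the log, so its head has the law of the first decision
    alone, whatever happens afterwards.\<close>
  have hd_run: "map_pmf hd (run ?P ?I \<sigma> 2) =
      map_pmf (\<lambda>x. if x = Assign 0 1 then Accepted 0 1 2 else Unassigned) (\<sigma> [])"
  proof -
    have "map_pmf hd (?tail (?first x)) = return_pmf (hd (?first x))" for x
      by (cases "x = Assign 0 1") (simp_all add: map_bind_pmf map_pmf_comp)
    then have "map_pmf hd (run ?P ?I \<sigma> 2) = bind_pmf (\<sigma> []) (\<lambda>x. return_pmf (hd (?first x)))"
      unfolding run map_bind_pmf[of hd "\<sigma> []"] by (simp only:)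
    also have "\<dots> = map_pmf (\<lambda>x. hd (?first x)) (\<sigma> [])"
      by (simp add: map_pmf_def)
    finally show ?thesis by (simp add: if_distrib cong: if_cong)
  qed
  have "expected_reward ?P ?I \<sigma> \<le>
      measure_pmf.expectation (run ?P ?I \<sigma> 2) (\<lambda>h. if hd h = Unassigned then c else 1)"
    unfolding expected_reward_def prophet_problem_sel
  proof (rule integral_mono_AE)
    show "integrable (run ?P ?I \<sigma> 2) (total_reward ?P ?I)"
      by (rule integrable_total_reward[of _ "1 / \<epsilon>"]) (use assms in auto)
    show "integrable (run ?P ?I \<sigma> 2) (\<lambda>h. if hd h = Unassigned then c else 1)"
      by (rule measure_pmf.integrable_const_bound[of _ "c + 1"]) (use c_nonneg in auto)
  qed (use le in \<open>auto simp: AE_measure_pmf_iff\<close>)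
  also have "\<dots> = measure_pmf.expectation (map_pmf hd (run ?P ?I \<sigma> 2))
      (\<lambda>e. if e = Unassigned then c else 1)"
    by simp
  \<comment> \<open>Writing the case distinction as an affine function of an indicator makes the
    expectation affine in \<open>p\<close>.\<close>
  also have "\<dots> = measure_pmf.expectation (\<sigma> []) (\<lambda>x. c + (1 - c) * indicator {Assign 0 1} x)"
    unfolding hd_run integral_map_pmf by (intro Bochner_Integration.integral_cong) auto
  also have "\<dots> = c + (1 - c) * p"
    by (subst Bochner_Integration.integral_add)
      (auto simp: p_def measure_pmf_single emeasure_pmf_single intro!: integrable_real_indicator)
  also have "\<dots> = p + (if b then (1 - p) / \<epsilon> else 0)"
    by (simp add: c_def algebra_simps diff_divide_distrib)
  finally show ?thesis .
qed

theorem theorem3: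
  fixes \<zeta> :: real and ALG :: "(nat, nat) algorithm"
  assumes "\<zeta> > 0" and "online_algorithm ALG"
  shows "\<not> competitive_on
    {P. valid_problem P \<and> (\<forall>e\<in>edges P. accept_prob P e = 1) \<and> levels P = 1} (1 / 2 + \<zeta>) ALG"
proof
  assume comp: "competitive_on
    {P. valid_problem P \<and> (\<forall>e\<in>edges P. accept_prob P e = 1) \<and> levels P = 1} (1 / 2 + \<zeta>) ALG"
  \<comment> \<open>The cap 1 makes \<epsilon> a probability. With \<epsilon> \<le> \<zeta> as well,
    (1/2 + \<zeta>)(2 - \<epsilon>) is at least 1 + \<zeta>/2, which exceeds 1.\<close>
  define \<epsilon> where "\<epsilon> = min 1 \<zeta>"
  have \<epsilon>: "0 < \<epsilon>" "\<epsilon> \<le> 1" "\<epsilon> \<le> \<zeta>"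
    using assms(1) by (auto simp: \<epsilon>_def)
  let ?P = "prophet_problem \<epsilon>" and ?I = prophet_arrivals
  define \<sigma> where "\<sigma> b = strategy_of (ALG ?P) (?I b)" for b
  define p where "p = pmf (ALG ?P [Some 0] []) (Assign 0 1)"
  have adm: "admissible ?P (?I b) (\<sigma> b)" for b
    using assms(2) valid_prophet_problem[OF \<epsilon>(1,2)] by (auto simp: online_algorithm_def \<sigma>_def)
  \<comment> \<open>Here the online restriction enters: at time 1 both arrival sequences look alike,
    so the same \<open>p\<close> serves for both values of \<open>b\<close>.\<close>
  have first: "\<sigma> b [] = ALG ?P [Some 0] []" for b
    by (simp add: \<sigma>_def strategy_of_def)
  have alg: "expected_reward ?P (?I b) (\<sigma> b) \<le> p + (if b then (1 - p) / \<epsilon> else 0)" for b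
    using expected_reward_prophet_problem_le[OF \<epsilon>(1,2) adm] by (simp only: first p_def)
  have "(1 / 2 + \<zeta>) * (2 - \<epsilon>) = (1 / 2 + \<zeta>) * (\<epsilon> * (1 / \<epsilon>) + (1 - \<epsilon>) * 1)"
    using \<epsilon> by simp
  also have "\<dots> \<le> (1 / 2 + \<zeta>) * (\<epsilon> * OPT ?P (?I True) + (1 - \<epsilon>) * OPT ?P (?I False))"
    using \<epsilon> assms(1)
    by (intro mult_left_mono add_mono OPT_prophet_problem_True OPT_prophet_problem_False) auto
  also have "\<dots> = (1 / 2 + \<zeta>) * measure_pmf.expectation (arrivals ?P) (OPT ?P)"
    using \<epsilon> by (simp add: arrivals_prophet_problem)
  also have "\<dots> \<le> measure_pmf.expectation (arrivals ?P)
      (\<lambda>I. expected_reward ?P I (strategy_of (ALG ?P) I))"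
    using comp valid_prophet_problem[OF \<epsilon>(1,2)] by (simp add: competitive_on_def)
  also have "\<dots> = \<epsilon> * expected_reward ?P (?I True) (\<sigma> True)
      + (1 - \<epsilon>) * expected_reward ?P (?I False) (\<sigma> False)"
    using \<epsilon> by (simp add: arrivals_prophet_problem \<sigma>_def)
  also have "\<dots> \<le> \<epsilon> * (p + (1 - p) / \<epsilon>) + (1 - \<epsilon>) * p"
    using \<epsilon> alg[of True] alg[of False] by (intro add_mono mult_left_mono) auto
  \<comment> \<open>The terms in \<open>p\<close> cancel: with this \<epsilon>, taking task 0 and
    waiting for task 1 are worth equally much to an online algorithm.\<close>
  also have "\<dots> = 1"
    using \<epsilon> by (simp add: field_simps)
  finally have "(1 / 2 + \<zeta>) * (2 - \<epsilon>) \<le> 1" .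
  moreover have "\<zeta> * \<epsilon> \<le> \<zeta> * 1"
    using \<epsilon> by (intro mult_left_mono) auto
  moreover have "(1 / 2 + \<zeta>) * (2 - \<epsilon>) = 1 + 2 * \<zeta> - \<epsilon> / 2 - \<zeta> * \<epsilon>"
    by (simp add: field_simps)
  ultimately show False
    using \<epsilon> by linarith
qed

end
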